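(* Let $\mathbb{K}$ be a field of characteristic not $2$ and let $(\mathcal{A},\mu,\alpha)$ be a multiplicative Hom-associative affgebra over $\mathbb{K}$; write $ab=\mu(a,b)$. Then $\mathcal{A}$, with the same map $\alpha$ and the bracket $$\{a,b\}=\langle ab,\,ba,\,\alpha(b)\rangle\qquad(a,b\in\mathcal{A}),$$ is a multiplicative Hom-Lie affgebra.
   Context: An abelian heap is a set $\mathcal{A}$ with a ternary operation $\langle-,-,-\rangle$ satisfying $\langle\langle a,b,c\rangle,d,e\rangle=\langle a,b,\langle c,d,e\rangle\rangle$, $\langle a,a,b\rangle=b=\langle b,a,a\rangle$ and $\langle a,b,c\rangle=\langle c,b,a\rangle$; $\langle a_1,\dots,a_{2n+1}\rangle$ denotes any iterated application of the operation (the result does not depend on bracketing). An affine space over $\mathbb{K}$ is a non-empty abelian heap $\mathcal{A}$ with an action $\mathbb{K}\times\mathcal{A}\times\mathcal{A}\to\mathcal{A}$, $(\xi,a,b)\mapsto\xi\blacktriangleright_a b$, such that: $\xi\blacktriangleright_a-$ and $-\blacktriangleright_a b$ are heap homomorphisms ($\mathbb{K}$ being a heap via $\xi-\zeta+\gamma$); $(\xi\zeta)\blacktriangleright_a b=\xi\blacktriangleright_a(\zeta\blacktriangleright_a b)$; $\xi\blacktriangleright_a b=\langle\xi\blacktriangleright_c b,\xi\blacktriangleright_c a,a\rangle$; $0\blacktriangleright_a b=a$, $1\blacktriangleright_a b=b$. An affine map is a heap homomorphism $f$ with $f(\xi\blacktriangleright_a b)=\xi\blacktriangleright_{f(a)}f(b)$.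 A map $\mathcal{A}\times\mathcal{A}\to\mathcal{A}$ is bi-affine if it is affine in each argument. A Hom-associative affgebra is a triple $(\mathcal{A},\mu,\alpha)$ with $\mathcal{A}$ an affine space, $\mu:\mathcal{A}\times\mathcal{A}\to\mathcal{A}$ bi-affine, $\alpha:\mathcal{A}\to\mathcal{A}$ affine, such that $\mu(\alpha(a),\mu(b,c))=\mu(\mu(a,b),\alpha(c))$ for all $a,b,c$. It is multiplicative if $\alpha(\mu(a,b))=\mu(\alpha(a),\alpha(b))$. A Hom-Lie affgebra is a triple $(\mathcal{A},\{-,-\},\alpha)$ with $\mathcal{A}$ an affine space, $\{-,-\}:\mathcal{A}\times\mathcal{A}\to\mathcal{A}$ bi-affine, $\alpha:\mathcal{A}\to\mathcal{A}$ affine, such that for all $a,b,c$: $\langle\{a,b\},\{a,a\},\{b,a\}\rangle=\{b,b\}$ and $\langle\{\alpha(a),\{b,c\}\},\{\alpha(a),\{a,a\}\},\{\alpha(b),\{c,a\}\},\{\alpha(b),\{b,b\}\},\{\alpha(c),\{a,b\}\}\rangle=\{\alpha(c),\{c,c\}\}$. It is multiplicative if $\alpha\{a,b\}=\{\alpha(a),\alpha(b)\}$ for all $a,b$. *)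

theory Defs
  imports Main "HOL-Library.FuncSet"
begin

locale abelian_heap =
  fixes A :: "'a set" and tern :: "'a \<Rightarrow> 'a \<Rightarrow> 'a \<Rightarrow> 'a" (\<open>\<langle>_, _, _\<rangle>\<close>)
  assumes tern_closed: "\<lbrakk>a \<in> A; b \<in> A; c \<in> A\<rbrakk> \<Longrightarrow> \<langle>a, b, c\<rangle> \<in> A"
    and tern_assoc: "\<lbrakk>a \<in> A; b \<in> A; c \<in> A; d \<in> A; e \<in> A\<rbrakk>
      \<Longrightarrow> \<langle>\<langle>a, b, c\<rangle>, d, e\<rangle> = \<langle>a, b, \<langle>c, d, e\<rangle>\<rangle>"
    and tern_left: "\<lbrakk>a \<in> A; b \<in> A\<rbrakk> \<Longrightarrow> \<langle>a, a, b\<rangle> = b"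
    and tern_right: "\<lbrakk>a \<in> A; b \<in> A\<rbrakk> \<Longrightarrow> \<langle>b, a, a\<rangle> = b"
    and tern_comm: "\<lbrakk>a \<in> A; b \<in> A; c \<in> A\<rbrakk> \<Longrightarrow> \<langle>a, b, c\<rangle> = \<langle>c, b, a\<rangle>"

definition heap_hom ::
  "'a set \<Rightarrow> ('a \<Rightarrow> 'a \<Rightarrow> 'a \<Rightarrow> 'a) \<Rightarrow> 'b set \<Rightarrow> ('b \<Rightarrow> 'b \<Rightarrow> 'b \<Rightarrow> 'b) \<Rightarrow> ('a \<Rightarrow> 'b) \<Rightarrow> bool"
  where "heap_hom A s B t f \<longleftrightarrow>
    f \<in> A \<rightarrow> B \<and> (\<forall>a\<in>A. \<forall>b\<in>A. \<forall>c\<in>A. f (s a b c) = t (f a) (f b) (f c))"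

definition group_tern :: "'g \<Rightarrow> 'g \<Rightarrow> 'g \<Rightarrow> 'g :: ab_group_add"
  where "group_tern \<xi> \<zeta> \<gamma> = \<xi> - \<zeta> + \<gamma>"

text \<open>The scalar field is the whole type \<open>'k\<close>; \<open>act \<xi> a b\<close> is written \<open>\<xi> \<triangleright>\<^bsub>a\<^esub> b\<close>.\<close>

locale affine_space = abelian_heap A tern
  for A :: "'a set" and tern :: "'a \<Rightarrow> 'a \<Rightarrow> 'a \<Rightarrow> 'a" (\<open>\<langle>_, _, _\<rangle>\<close>) +
  fixes act :: "'k::field \<Rightarrow> 'a \<Rightarrow> 'a \<Rightarrow> 'a" (\<open>_ \<triangleright>\<^bsub>_\<^esub> _\<close> [76, 0, 75] 75)
  assumes nonempty: "A \<noteq> {}"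
    and act_closed: "\<lbrakk>a \<in> A; b \<in> A\<rbrakk> \<Longrightarrow> \<xi> \<triangleright>\<^bsub>a\<^esub> b \<in> A"
    and act_hom_point: "a \<in> A \<Longrightarrow> heap_hom A tern A tern (\<lambda>b. \<xi> \<triangleright>\<^bsub>a\<^esub> b)"
    and act_hom_scalar: "\<lbrakk>a \<in> A; b \<in> A\<rbrakk> \<Longrightarrow> heap_hom UNIV group_tern A tern (\<lambda>\<xi>. \<xi> \<triangleright>\<^bsub>a\<^esub> b)"
    and act_mult: "\<lbrakk>a \<in> A; b \<in> A\<rbrakk> \<Longrightarrow> (\<xi> * \<zeta>) \<triangleright>\<^bsub>a\<^esub> b = \<xi> \<triangleright>\<^bsub>a\<^esub> (\<zeta> \<triangleright>\<^bsub>a\<^esub> b)"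
    and act_base_change: "\<lbrakk>a \<in> A; b \<in> A; c \<in> A\<rbrakk>
      \<Longrightarrow> \<xi> \<triangleright>\<^bsub>a\<^esub> b = \<langle>\<xi> \<triangleright>\<^bsub>c\<^esub> b, \<xi> \<triangleright>\<^bsub>c\<^esub> a, a\<rangle>"
    and act_zero: "\<lbrakk>a \<in> A; b \<in> A\<rbrakk> \<Longrightarrow> 0 \<triangleright>\<^bsub>a\<^esub> b = a"
    and act_one: "\<lbrakk>a \<in> A; b \<in> A\<rbrakk> \<Longrightarrow> 1 \<triangleright>\<^bsub>a\<^esub> b = b"

definition affine_map ::
  "'a set \<Rightarrow> ('a \<Rightarrow> 'a \<Rightarrow> 'a \<Rightarrow> 'a) \<Rightarrow> ('k::field \<Rightarrow> 'a \<Rightarrow> 'a \<Rightarrow> 'a) \<Rightarrow>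
   'b set \<Rightarrow> ('b \<Rightarrow> 'b \<Rightarrow> 'b \<Rightarrow> 'b) \<Rightarrow> ('k \<Rightarrow> 'b \<Rightarrow> 'b \<Rightarrow> 'b) \<Rightarrow> ('a \<Rightarrow> 'b) \<Rightarrow> bool"
  where "affine_map A s p B t q f \<longleftrightarrow>
    heap_hom A s B t f \<and> (\<forall>\<xi>. \<forall>a\<in>A. \<forall>b\<in>A. f (p \<xi> a b) = q \<xi> (f a) (f b))"

definition bi_affine ::
  "'a set \<Rightarrow> ('a \<Rightarrow> 'a \<Rightarrow> 'a \<Rightarrow> 'a) \<Rightarrow> ('k::field \<Rightarrow> 'a \<Rightarrow> 'a \<Rightarrow> 'a) \<Rightarrow> ('a \<Rightarrow> 'a \<Rightarrow> 'a) \<Rightarrow> bool"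
  where "bi_affine A t p m \<longleftrightarrow>
    (\<forall>a\<in>A. affine_map A t p A t p (\<lambda>b. m a b)) \<and>
    (\<forall>b\<in>A. affine_map A t p A t p (\<lambda>a. m a b))"

definition multiplicative_on :: "'a set \<Rightarrow> ('a \<Rightarrow> 'a \<Rightarrow> 'a) \<Rightarrow> ('a \<Rightarrow> 'a) \<Rightarrow> bool"
  where "multiplicative_on A m \<alpha> \<longleftrightarrow> (\<forall>a\<in>A. \<forall>b\<in>A. \<alpha> (m a b) = m (\<alpha> a) (\<alpha> b))"

locale hom_associative_affgebra = affine_space A tern act
  for A :: "'a set" and tern :: "'a \<Rightarrow> 'a \<Rightarrow> 'a \<Rightarrow> 'a" (\<open>\<langle>_, _, _\<rangle>\<close>)
    and act :: "'k::field \<Rightarrow> 'a \<Rightarrow> 'a \<Rightarrow> 'a" (\<open>_ \<triangleright>\<^bsub>_\<^esub> _\<close> [76, 0, 75] 75) +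
  fixes \<mu> :: "'a \<Rightarrow> 'a \<Rightarrow> 'a" and \<alpha> :: "'a \<Rightarrow> 'a"
  assumes mult_bi_affine: "bi_affine A tern act \<mu>"
    and twist_affine: "affine_map A tern act A tern act \<alpha>"
    and hom_assoc: "\<lbrakk>a \<in> A; b \<in> A; c \<in> A\<rbrakk> \<Longrightarrow> \<mu> (\<alpha> a) (\<mu> b c) = \<mu> (\<mu> a b) (\<alpha> c)"

text \<open>The five-fold heap bracket in the Hom-Jacobi identity is written out in its left-nested form;
  by the heap axioms all bracketings agree.\<close>

locale hom_lie_affgebra = affine_space A tern act
  for A :: "'a set" and tern :: "'a \<Rightarrow> 'a \<Rightarrow> 'a \<Rightarrow> 'a" (\<open>\<langle>_, _, _\<rangle>\<close>)
    and act :: "'k::field \<Rightarrow> 'a \<Rightarrow> 'a \<Rightarrow> 'a" (\<open>_ \<triangleright>\<^bsub>_\<^esub> _\<close> [76, 0, 75] 75) +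
  fixes bracket :: "'a \<Rightarrow> 'a \<Rightarrow> 'a" (\<open>\<lbrace>_, _\<rbrace>\<close>) and \<alpha> :: "'a \<Rightarrow> 'a"
  assumes bracket_bi_affine: "bi_affine A tern act bracket"
    and twist_affine: "affine_map A tern act A tern act \<alpha>"
    and antisymmetry: "\<lbrakk>a \<in> A; b \<in> A\<rbrakk> \<Longrightarrow> \<langle>\<lbrace>a, b\<rbrace>, \<lbrace>a, a\<rbrace>, \<lbrace>b, a\<rbrace>\<rangle> = \<lbrace>b, b\<rbrace>"
    and hom_jacobi: "\<lbrakk>a \<in> A; b \<in> A; c \<in> A\<rbrakk> \<Longrightarrow>
      \<langle>\<langle>\<lbrace>\<alpha> a, \<lbrace>b, c\<rbrace>\<rbrace>, \<lbrace>\<alpha> a, \<lbrace>a, a\<rbrace>\<rbrace>, \<lbrace>\<alpha> b, \<lbrace>c, a\<rbrace>\<rbrace>\<rangle>, \<lbrace>\<alpha> b, \<lbrace>b, b\<rbrace>\<rbrace>, \<lbrace>\<alpha> c, \<lbrace>a, b\<rbrace>\<rbrace>\<rangle>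
        = \<lbrace>\<alpha> c, \<lbrace>c, c\<rbrace>\<rbrace>"

end

theory Submission
  imports Defs
begin

text \<open>
  Once an origin is chosen, an abelian heap is an abelian group with \<open>\<langle>a, b, c\<rangle> = a - b + c\<close>, and the
  bracket becomes \<open>{a, b} = ab - ba + \<alpha>(b)\<close>.  The commutator is a difference of two points, hence a
  vector; adding \<open>\<alpha>(b)\<close> turns it into a point that does not depend on the origin, and
  \<open>{a, a} = \<alpha>(a)\<close>.

  The bracket is bi-affine because a heap combination of affine maps is affine
  (\<open>affine_map_tern\<close>). This rests on the medial law of abelian heaps, which interchanges the rows
  and columns of a three by three array.  In its first argument the term \<open>\<alpha>(b)\<close> is constant, and
  constant maps are affine.

  For the Hom-Jacobi identity, bi-affinity and multiplicativity expand \<open>{\<alpha>(a), {b, c}}\<close> into three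
  kinds of terms: four triple products such as \<open>\<alpha>(a)(bc)\<close>, the products
  \<open>\<alpha>(a)\<alpha>(c) - \<alpha>(c)\<alpha>(a) + \<alpha>(b)\<alpha>(c) - \<alpha>(c)\<alpha>(b)\<close>, and \<open>\<alpha>(\<alpha>(c))\<close>.  In the cyclic sum the triple
  products cancel by Hom-associativity, exactly as for the commutator of an associative algebra;
  the double products cancel by antisymmetry.  The terms \<open>\<alpha>(\<alpha>(a))\<close>, \<open>\<alpha>(\<alpha>(b))\<close>, \<open>\<alpha>(\<alpha>(c))\<close> that
  remain match the diagonal terms \<open>{\<alpha>(a), {a, a}} = \<alpha>(\<alpha>(a))\<close> of the identity.  The cancellation is
  isolated in the lemma \<open>cyclic_cancellation\<close>, a statement about abelian heaps alone.
\<close>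

section \<open>Abelian heaps with an origin\<close>

text \<open>
  Identities in an abelian heap are decided in the group obtained by fixing an origin.  No inverses
  are introduced: an equation for a heap bracket is read as an equation between sums, moving the
  entries with a negative sign to the other side, after which commutativity and cancellation suffice.
\<close>

locale pointed_abelian_heap = abelian_heap A tern
  for A :: "'a set" and tern :: "'a \<Rightarrow> 'a \<Rightarrow> 'a \<Rightarrow> 'a" (\<open>\<langle>_, _, _\<rangle>\<close>) +
  fixes z :: 'a
  assumes origin: "z \<in> A"
begin

definition plus :: "'a \<Rightarrow> 'a \<Rightarrow> 'a" (infixr \<open>\<oplus>\<close> 65)
  where "x \<oplus> y = \<langle>x, z, y\<rangle>"

lemma plus_closed: "\<lbrakk>x \<in> A; y \<in> A\<rbrakk> \<Longrightarrow> x \<oplus> y \<in> A"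
  by (simp add: plus_def origin tern_closed)

lemma plus_comm: "\<lbrakk>x \<in> A; y \<in> A\<rbrakk> \<Longrightarrow> x \<oplus> y = y \<oplus> x"
  unfolding plus_def by (rule tern_comm) (simp_all add: origin)

lemma plus_assoc: "\<lbrakk>x \<in> A; y \<in> A; w \<in> A\<rbrakk> \<Longrightarrow> (x \<oplus> y) \<oplus> w = x \<oplus> (y \<oplus> w)"
  by (simp add: plus_def origin tern_assoc)

lemma plus_lcomm: "\<lbrakk>x \<in> A; y \<in> A; w \<in> A\<rbrakk> \<Longrightarrow> x \<oplus> (y \<oplus> w) = y \<oplus> (x \<oplus> w)"
  by (metis plus_assoc plus_comm)

lemmas plus_ac = plus_closed plus_assoc plus_comm plus_lcomm

lemma plus_cancel:
  assumes "x \<in> A" "y \<in> A" "w \<in> A" and eq: "y \<oplus> x = w \<oplus> x"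
  shows "y = w"
proof -
  have "\<langle>v \<oplus> x, x, z\<rangle> = v" if "v \<in> A" for v
    using that assms(1) origin by (simp add: plus_def tern_assoc tern_left tern_right)
  then show ?thesis
    using assms by metis
qed

lemma tern_plus:
  assumes "a \<in> A" "b \<in> A" "c \<in> A"
  shows "\<langle>a, b, c\<rangle> \<oplus> b = a \<oplus> c"
proof -
  have "\<langle>a, b, c\<rangle> \<oplus> b = \<langle>a, b, \<langle>b, z, c\<rangle>\<rangle>"
    using assms origin by (simp add: plus_def tern_assoc tern_comm[of c z b])
  also have "\<dots> = \<langle>\<langle>a, b, b\<rangle>, z, c\<rangle>"
    using assms origin by (simp add: tern_assoc)
  finally show ?thesis
    using assms by (simp add: plus_def tern_right)
qed

text \<open>The bracket of three brackets carries the signs \<open>+ - +\<close>, \<open>- + -\<close>, \<open>+ - +\<close> along its rows.\<close>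

lemma tern_array_plus:
  assumes "a \<in> A" "b \<in> A" "c \<in> A" "d \<in> A" "e \<in> A" "f \<in> A" "g \<in> A" "h \<in> A" "i \<in> A"
  shows "\<langle>\<langle>a, b, c\<rangle>, \<langle>d, e, f\<rangle>, \<langle>g, h, i\<rangle>\<rangle> \<oplus> (b \<oplus> d \<oplus> f \<oplus> h) = a \<oplus> c \<oplus> e \<oplus> g \<oplus> i"
proof -
  let ?X = "\<langle>a, b, c\<rangle>" and ?Y = "\<langle>d, e, f\<rangle>" and ?Z = "\<langle>g, h, i\<rangle>"
  have closed: "?X \<in> A" "?Y \<in> A" "?Z \<in> A" "\<langle>?X, ?Y, ?Z\<rangle> \<in> A"
    using assms by (simp_all add: tern_closed)
  have "\<langle>?X, ?Y, ?Z\<rangle> \<oplus> (b \<oplus> d \<oplus> f \<oplus> h) = \<langle>?X, ?Y, ?Z\<rangle> \<oplus> (b \<oplus> (?Y \<oplus> e) \<oplus> h)"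
    using assms by (simp add: tern_plus plus_assoc)
  also have "\<dots> = (\<langle>?X, ?Y, ?Z\<rangle> \<oplus> ?Y) \<oplus> b \<oplus> e \<oplus> h"
    using assms closed by (simp add: plus_ac)
  also have "\<dots> = (?X \<oplus> ?Z) \<oplus> b \<oplus> e \<oplus> h"
    using closed by (simp add: tern_plus)
  also have "\<dots> = (?X \<oplus> b) \<oplus> (?Z \<oplus> h) \<oplus> e"
    using assms closed by (simp add: plus_ac)
  also have "\<dots> = a \<oplus> c \<oplus> e \<oplus> g \<oplus> i"
    using assms by (simp add: tern_plus plus_ac)
  finally show ?thesis .
qed

end

section \<open>Identities in abelian heaps\<close>

context abelian_heap
begin

text \<open>The sign pattern of a three by three array of nested brackets is symmetric under transposition.\<close>

lemma tern_medial:
  assumes "a \<in> A" "b \<in> A" "c \<in> A" "d \<in> A" "e \<in> A" "f \<in> A" "g \<in> A" "h \<in> A" "i \<in> A"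
  shows "\<langle>\<langle>a, b, c\<rangle>, \<langle>d, e, f\<rangle>, \<langle>g, h, i\<rangle>\<rangle> = \<langle>\<langle>a, d, g\<rangle>, \<langle>b, e, h\<rangle>, \<langle>c, f, i\<rangle>\<rangle>" (is "?L = ?R")
proof -
  interpret pointed_abelian_heap A tern a
    by unfold_locales (rule assms)
  write plus (infixr \<open>\<oplus>\<close> 65)
  have "?L \<oplus> (b \<oplus> d \<oplus> f \<oplus> h) = ?R \<oplus> (d \<oplus> b \<oplus> h \<oplus> f)"
    unfolding tern_array_plus[OF assms]
    by (subst tern_array_plus) (use assms in \<open>simp_all add: plus_ac\<close>)
  also have "d \<oplus> b \<oplus> h \<oplus> f = b \<oplus> d \<oplus> f \<oplus> h"
    using assms by (simp add: plus_ac)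
  finally show ?thesis
    by (rule plus_cancel[rotated 3]) (use assms in \<open>simp_all add: plus_closed tern_closed\<close>)
qed

text \<open>
  The three arrays are the expansions of \<open>{\<alpha>(a), {b, c}}\<close> and its cyclic shifts.  The entries \<open>p\<^sub>i\<close>
  are the triple products in cyclic order and \<open>n\<^sub>i\<close> those in anticyclic order, each standing for
  both bracketings; \<open>ab\<close> stands for \<open>\<alpha>(a)\<alpha>(b)\<close> and \<open>ha\<close> for \<open>\<alpha>(\<alpha>(a))\<close>, and so on.  Every \<open>p\<^sub>i\<close>, every
  \<open>n\<^sub>i\<close> and every double product occurs equally often with either sign.
\<close>

lemma cyclic_cancellation:
  assumes p: "p\<^sub>1 \<in> A" "p\<^sub>2 \<in> A" "p\<^sub>3 \<in> A" and n: "n\<^sub>1 \<in> A" "n\<^sub>2 \<in> A" "n\<^sub>3 \<in> A"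
    and d: "ab \<in> A" "ba \<in> A" "ac \<in> A" "ca \<in> A" "bc \<in> A" "cb \<in> A"
    and h: "ha \<in> A" "hb \<in> A" "hc \<in> A"
  shows "\<langle>\<langle>\<langle>\<langle>p\<^sub>1, n\<^sub>1, ac\<rangle>, \<langle>p\<^sub>2, n\<^sub>3, ca\<rangle>, \<langle>bc, cb, hc\<rangle>\<rangle>, ha,
            \<langle>\<langle>p\<^sub>2, n\<^sub>2, ba\<rangle>, \<langle>p\<^sub>3, n\<^sub>1, ab\<rangle>, \<langle>ca, ac, ha\<rangle>\<rangle>\<rangle>, hb,
            \<langle>\<langle>p\<^sub>3, n\<^sub>3, cb\<rangle>, \<langle>p\<^sub>1, n\<^sub>2, bc\<rangle>, \<langle>ab, ba, hb\<rangle>\<rangle>\<rangle> = hc"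
    (is "\<langle>\<langle>?Ja, ha, ?Jb\<rangle>, hb, ?Jc\<rangle> = hc")
proof -
  interpret pointed_abelian_heap A tern ha
    by unfold_locales (rule h)
  write plus (infixr \<open>\<oplus>\<close> 65)
  note atoms = p n d h
  let ?Na = "n\<^sub>1 \<oplus> p\<^sub>2 \<oplus> ca \<oplus> cb"
    and ?Nb = "n\<^sub>2 \<oplus> p\<^sub>3 \<oplus> ab \<oplus> ac"
    and ?Nc = "n\<^sub>3 \<oplus> p\<^sub>1 \<oplus> bc \<oplus> ba"
  have closed: "?Ja \<in> A" "?Jb \<in> A" "?Jc \<in> A" "\<langle>?Ja, ha, ?Jb\<rangle> \<in> A" "?Na \<in> A" "?Nb \<in> A" "?Nc \<in> A"
    "\<langle>\<langle>?Ja, ha, ?Jb\<rangle>, hb, ?Jc\<rangle> \<in> A"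
    using atoms by (simp_all add: tern_closed plus_closed)
  define Ja Jb Jc Na Nb Nc where defs: "Ja = ?Ja" "Jb = ?Jb" "Jc = ?Jc" "Na = ?Na" "Nb = ?Nb" "Nc = ?Nc"
  note closed' = closed[folded defs]
  have arrays:
    "Ja \<oplus> Na = p\<^sub>1 \<oplus> ac \<oplus> n\<^sub>3 \<oplus> bc \<oplus> hc"
    "Jb \<oplus> Nb = p\<^sub>2 \<oplus> ba \<oplus> n\<^sub>1 \<oplus> ca \<oplus> ha"
    "Jc \<oplus> Nc = p\<^sub>3 \<oplus> cb \<oplus> n\<^sub>2 \<oplus> ab \<oplus> hb"
    unfolding defs by (rule tern_array_plus; fact atoms)+
  let ?N = "ha \<oplus> hb \<oplus> Na \<oplus> Nb \<oplus> Nc"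
  have "\<langle>\<langle>Ja, ha, Jb\<rangle>, hb, Jc\<rangle> \<oplus> ?N = (\<langle>\<langle>Ja, ha, Jb\<rangle>, hb, Jc\<rangle> \<oplus> hb) \<oplus> ha \<oplus> Na \<oplus> Nb \<oplus> Nc"
    using closed' h by (simp add: plus_ac)
  also have "\<dots> = (\<langle>Ja, ha, Jb\<rangle> \<oplus> Jc) \<oplus> ha \<oplus> Na \<oplus> Nb \<oplus> Nc"
    using closed' h by (simp add: tern_plus)
  also have "\<dots> = (\<langle>Ja, ha, Jb\<rangle> \<oplus> ha) \<oplus> Jc \<oplus> Na \<oplus> Nb \<oplus> Nc"
    using closed' h by (simp add: plus_ac)
  also have "\<dots> = (Ja \<oplus> Jb) \<oplus> Jc \<oplus> Na \<oplus> Nb \<oplus> Nc"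
    using closed' h by (simp add: tern_plus)
  also have "\<dots> = (Ja \<oplus> Na) \<oplus> (Jb \<oplus> Nb) \<oplus> (Jc \<oplus> Nc)"
    using closed' h by (simp add: plus_ac)
  also have "\<dots> = hc \<oplus> ?N"
    unfolding arrays unfolding defs using atoms by (simp add: plus_ac)
  finally have "\<langle>\<langle>Ja, ha, Jb\<rangle>, hb, Jc\<rangle> = hc"
    by (rule plus_cancel[rotated 3]) (use closed' h in \<open>simp_all add: plus_closed\<close>)
  then show ?thesis
    unfolding defs .
qed

end

section \<open>Heap combinations of affine maps\<close>

context affine_space
begin

lemma act_self: "a \<in> A \<Longrightarrow> \<xi> \<triangleright>\<^bsub>a\<^esub> a = a"
  using act_base_change[of a a a \<xi>] by (simp add: act_closed tern_left)

lemma act_tern_point: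
  "\<lbrakk>o' \<in> A; a \<in> A; b \<in> A; c \<in> A\<rbrakk> \<Longrightarrow>
    \<xi> \<triangleright>\<^bsub>o'\<^esub> \<langle>a, b, c\<rangle> = \<langle>\<xi> \<triangleright>\<^bsub>o'\<^esub> a, \<xi> \<triangleright>\<^bsub>o'\<^esub> b, \<xi> \<triangleright>\<^bsub>o'\<^esub> c\<rangle>"
  using act_hom_point[of o' \<xi>] by (simp add: heap_hom_def)

text \<open>
  Transporting all actions to one common base point turns both sides into arrays of nine entries,
  which are transposes of each other.
\<close>

lemma act_tern:
  assumes "a \<in> A" "b \<in> A" "c \<in> A" "a' \<in> A" "b' \<in> A" "c' \<in> A"
  shows "\<xi> \<triangleright>\<^bsub>\<langle>a, b, c\<rangle>\<^esub> \<langle>a', b', c'\<rangle> = \<langle>\<xi> \<triangleright>\<^bsub>a\<^esub> a', \<xi> \<triangleright>\<^bsub>b\<^esub> b', \<xi> \<triangleright>\<^bsub>c\<^esub> c'\<rangle>"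
proof -
  obtain z where z: "z \<in> A"
    using nonempty by blast
  have "\<xi> \<triangleright>\<^bsub>\<langle>a, b, c\<rangle>\<^esub> \<langle>a', b', c'\<rangle> =
      \<langle>\<langle>\<xi> \<triangleright>\<^bsub>z\<^esub> a', \<xi> \<triangleright>\<^bsub>z\<^esub> b', \<xi> \<triangleright>\<^bsub>z\<^esub> c'\<rangle>, \<langle>\<xi> \<triangleright>\<^bsub>z\<^esub> a, \<xi> \<triangleright>\<^bsub>z\<^esub> b, \<xi> \<triangleright>\<^bsub>z\<^esub> c\<rangle>, \<langle>a, b, c\<rangle>\<rangle>"
    using assms z act_base_change[of "\<langle>a, b, c\<rangle>" "\<langle>a', b', c'\<rangle>" z \<xi>]
    by (simp add: tern_closed act_tern_point)
  also have "\<dots> = \<langle>\<langle>\<xi> \<triangleright>\<^bsub>z\<^esub> a', \<xi> \<triangleright>\<^bsub>z\<^esub> a, a\<rangle>, \<langle>\<xi> \<triangleright>\<^bsub>z\<^esub> b', \<xi> \<triangleright>\<^bsub>z\<^esub> b, b\<rangle>, \<langle>\<xi> \<triangleright>\<^bsub>z\<^esub> c', \<xi> \<triangleright>\<^bsub>z\<^esub> c, c\<rangle>\<rangle>"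
    using assms z by (intro tern_medial act_closed)
  also have "\<dots> = \<langle>\<xi> \<triangleright>\<^bsub>a\<^esub> a', \<xi> \<triangleright>\<^bsub>b\<^esub> b', \<xi> \<triangleright>\<^bsub>c\<^esub> c'\<rangle>"
    using assms z by (simp add: act_base_change[of a a' z] act_base_change[of b b' z] act_base_change[of c c' z])
  finally show ?thesis .
qed

lemma affine_map_const: "d \<in> A \<Longrightarrow> affine_map S s p A tern act (\<lambda>_. d)"
  by (simp add: affine_map_def heap_hom_def tern_left act_self)

lemma affine_map_tern:
  assumes "affine_map S s p A tern act f" "affine_map S s p A tern act g"
    "affine_map S s p A tern act h"
  shows "affine_map S s p A tern act (\<lambda>x. \<langle>f x, g x, h x\<rangle>)"
proof -
  have closed: "f x \<in> A" "g x \<in> A" "h x \<in> A" if "x \<in> S" for x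
    using that assms by (auto simp: affine_map_def heap_hom_def)
  have "\<langle>f (s x y w), g (s x y w), h (s x y w)\<rangle> =
      \<langle>\<langle>f x, g x, h x\<rangle>, \<langle>f y, g y, h y\<rangle>, \<langle>f w, g w, h w\<rangle>\<rangle>" if "x \<in> S" "y \<in> S" "w \<in> S" for x y w
    using that assms tern_medial[of "f x" "f y" "f w" "g x" "g y" "g w" "h x" "h y" "h w"]
    by (simp add: affine_map_def heap_hom_def closed)
  moreover have "\<langle>f (p \<xi> x y), g (p \<xi> x y), h (p \<xi> x y)\<rangle> =
      \<xi> \<triangleright>\<^bsub>\<langle>f x, g x, h x\<rangle>\<^esub> \<langle>f y, g y, h y\<rangle>" if "x \<in> S" "y \<in> S" for \<xi> x y
    using that assms by (simp add: affine_map_def act_tern closed)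
  ultimately show ?thesis
    by (simp add: affine_map_def heap_hom_def tern_closed closed)
qed

end

section \<open>The twisted commutator bracket\<close>

context hom_associative_affgebra
begin

definition commutator_bracket :: "'a \<Rightarrow> 'a \<Rightarrow> 'a" (\<open>\<lbrace>_, _\<rbrace>\<close>)
  where "\<lbrace>a, b\<rbrace> = \<langle>\<mu> a b, \<mu> b a, \<alpha> b\<rangle>"

lemma mult_affine:
  assumes "a \<in> A"
  shows "affine_map A tern act A tern act (\<mu> a)" "affine_map A tern act A tern act (\<lambda>b. \<mu> b a)"
  using mult_bi_affine assms by (auto simp: bi_affine_def)

lemma mult_closed: "\<lbrakk>a \<in> A; b \<in> A\<rbrakk> \<Longrightarrow> \<mu> a b \<in> A"
  using mult_affine(1)[of a] by (auto simp: affine_map_def heap_hom_def)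

lemma twist_closed: "a \<in> A \<Longrightarrow> \<alpha> a \<in> A"
  using twist_affine by (auto simp: affine_map_def heap_hom_def)

lemma mult_tern:
  assumes "a \<in> A" "b \<in> A" "c \<in> A" "d \<in> A"
  shows "\<mu> a \<langle>b, c, d\<rangle> = \<langle>\<mu> a b, \<mu> a c, \<mu> a d\<rangle>" "\<mu> \<langle>b, c, d\<rangle> a = \<langle>\<mu> b a, \<mu> c a, \<mu> d a\<rangle>"
  using mult_affine[of a] assms by (auto simp: affine_map_def heap_hom_def)

lemma twist_tern:
  "\<lbrakk>a \<in> A; b \<in> A; c \<in> A\<rbrakk> \<Longrightarrow> \<alpha> \<langle>a, b, c\<rangle> = \<langle>\<alpha> a, \<alpha> b, \<alpha> c\<rangle>"
  using twist_affine by (auto simp: affine_map_def heap_hom_def)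

lemma commutator_bracket_bi_affine: "bi_affine A tern act commutator_bracket"
  unfolding bi_affine_def commutator_bracket_def
  by (intro conjI ballI affine_map_tern affine_map_const mult_affine twist_affine twist_closed)

lemma commutator_bracket_self: "a \<in> A \<Longrightarrow> \<lbrace>a, a\<rbrace> = \<alpha> a"
  by (simp add: commutator_bracket_def mult_closed twist_closed tern_left)

text \<open>
  The commutator parts of \<open>{a, b}\<close> and \<open>{b, a}\<close> cancel, and \<open>\<alpha>(a)\<close> cancels against \<open>{a, a}\<close>.
\<close>

lemma commutator_bracket_antisymmetry:
  assumes "a \<in> A" "b \<in> A"
  shows "\<langle>\<lbrace>a, b\<rbrace>, \<lbrace>a, a\<rbrace>, \<lbrace>b, a\<rbrace>\<rangle> = \<lbrace>b, b\<rbrace>"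
proof -
  note closed = mult_closed twist_closed tern_closed
  have "\<langle>\<lbrace>a, b\<rbrace>, \<lbrace>a, a\<rbrace>, \<lbrace>b, a\<rbrace>\<rangle> =
      \<langle>\<langle>\<mu> a b, \<mu> b a, \<alpha> b\<rangle>, \<alpha> a, \<langle>\<alpha> a, \<mu> a b, \<mu> b a\<rangle>\<rangle>"
    using assms by (simp add: commutator_bracket_self)
      (simp add: commutator_bracket_def closed tern_comm[of "\<mu> b a" "\<mu> a b"])
  also have "\<dots> = \<langle>\<langle>\<alpha> b, \<mu> b a, \<mu> a b\<rangle>, \<mu> a b, \<mu> b a\<rangle>"
    using assms
    by (simp add: closed tern_assoc[symmetric] tern_right tern_comm[of "\<mu> a b" "\<mu> b a" "\<alpha> b"])
  also have "\<dots> = \<alpha> b"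
    using assms by (simp add: closed tern_assoc tern_left tern_right)
  finally show ?thesis
    using assms by (simp add: commutator_bracket_self)
qed

lemma commutator_bracket_multiplicative:
  assumes "multiplicative_on A \<mu> \<alpha>"
  shows "multiplicative_on A commutator_bracket \<alpha>"
  using assms
  by (simp add: multiplicative_on_def commutator_bracket_def twist_tern mult_closed twist_closed)

lemma commutator_bracket_nested:
  assumes "multiplicative_on A \<mu> \<alpha>" and "a \<in> A" "b \<in> A" "c \<in> A"
  shows "\<lbrace>\<alpha> a, \<lbrace>b, c\<rbrace>\<rbrace> =
    \<langle>\<langle>\<mu> (\<alpha> a) (\<mu> b c), \<mu> (\<alpha> a) (\<mu> c b), \<mu> (\<alpha> a) (\<alpha> c)\<rangle>,
     \<langle>\<mu> (\<mu> b c) (\<alpha> a), \<mu> (\<mu> c b) (\<alpha> a), \<mu> (\<alpha> c) (\<alpha> a)\<rangle>,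
     \<langle>\<mu> (\<alpha> b) (\<alpha> c), \<mu> (\<alpha> c) (\<alpha> b), \<alpha> (\<alpha> c)\<rangle>\<rangle>"
  using assms
  by (simp add: commutator_bracket_def multiplicative_on_def mult_tern twist_tern
      mult_closed twist_closed)

text \<open>
  Hom-associativity rewrites every \<open>(xy)\<alpha>(z)\<close> as \<open>\<alpha>(x)(yz)\<close>, so that only six distinct triple
  products remain and the cancellation of the cyclic sum applies.
\<close>

lemma commutator_bracket_hom_jacobi:
  assumes mult: "multiplicative_on A \<mu> \<alpha>" and abc: "a \<in> A" "b \<in> A" "c \<in> A"
  shows "\<langle>\<langle>\<lbrace>\<alpha> a, \<lbrace>b, c\<rbrace>\<rbrace>, \<lbrace>\<alpha> a, \<lbrace>a, a\<rbrace>\<rbrace>, \<lbrace>\<alpha> b, \<lbrace>c, a\<rbrace>\<rbrace>\<rangle>, \<lbrace>\<alpha> b, \<lbrace>b, b\<rbrace>\<rbrace>, \<lbrace>\<alpha> c, \<lbrace>a, b\<rbrace>\<rbrace>\<rangle>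
    = \<lbrace>\<alpha> c, \<lbrace>c, c\<rbrace>\<rbrace>"
proof -
  have diagonal: "\<lbrace>\<alpha> x, \<lbrace>x, x\<rbrace>\<rbrace> = \<alpha> (\<alpha> x)" if "x \<in> A" for x
    using that by (simp add: commutator_bracket_self twist_closed)
  show ?thesis
    unfolding diagonal[OF abc(1)] diagonal[OF abc(2)] diagonal[OF abc(3)]
      commutator_bracket_nested[OF mult abc] commutator_bracket_nested[OF mult abc(2,3,1)]
      commutator_bracket_nested[OF mult abc(3,1,2)]
      hom_assoc[OF abc, symmetric] hom_assoc[OF abc(2,3,1), symmetric]
      hom_assoc[OF abc(3,1,2), symmetric] hom_assoc[OF abc(2,1,3), symmetric]
      hom_assoc[OF abc(1,3,2), symmetric] hom_assoc[OF abc(3,2,1), symmetric]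
    by (rule cyclic_cancellation) (simp_all add: abc mult_closed twist_closed)
qed

lemma commutator_bracket_hom_lie:
  assumes "multiplicative_on A \<mu> \<alpha>"
  shows "hom_lie_affgebra A tern act commutator_bracket \<alpha>"
  by unfold_locales
    (fact commutator_bracket_bi_affine twist_affine commutator_bracket_antisymmetry
      commutator_bracket_hom_jacobi[OF assms])+

end

theorem proposition4p1:
  fixes A :: "'a set"
    and tern :: "'a \<Rightarrow> 'a \<Rightarrow> 'a \<Rightarrow> 'a"
    and act :: "'k::field \<Rightarrow> 'a \<Rightarrow> 'a \<Rightarrow> 'a"
    and \<mu> :: "'a \<Rightarrow> 'a \<Rightarrow> 'a"
    and \<alpha> :: "'a \<Rightarrow> 'a"
  assumes "CHAR('k) \<noteq> 2"
    and "hom_associative_affgebra A tern act \<mu> \<alpha>"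
    and "multiplicative_on A \<mu> \<alpha>"
  shows "hom_lie_affgebra A tern act (\<lambda>a b. tern (\<mu> a b) (\<mu> b a) (\<alpha> b)) \<alpha> \<and>
    multiplicative_on A (\<lambda>a b. tern (\<mu> a b) (\<mu> b a) (\<alpha> b)) \<alpha>"
proof -
  interpret hom_associative_affgebra A tern act \<mu> \<alpha>
    by (rule assms(2))
  have "commutator_bracket = (\<lambda>a b. tern (\<mu> a b) (\<mu> b a) (\<alpha> b))"
    by (simp add: fun_eq_iff commutator_bracket_def)
  then show ?thesis
    using commutator_bracket_hom_lie[OF assms(3)] commutator_bracket_multiplicative[OF assms(3)]
    by simp
qed

end
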